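(* Let $(n_k)_{k\ge 0}$ be a strictly monotone increasing sequence of integers that is ergodic for periodic systems, and let $G$ be a compact Abelian group, with Haar measure $m$, such that its dual group $\widehat{G}$ contains infinitely many multiple torsion. Then there exists a measurable function $f:G\to\mathbb{R}$ with $f \notin L^1(G)$ such that $\Gamma_f=G$, and hence $m(\Gamma_f)=1$.
   Context: $G$ is a compact Abelian topological group, written additively, and $m$ is its Haar measure, normalized so that $m(G)=1$; measurability, "a.e." and $L^1(G)$ refer to $m$. $\widehat{G}$ is the (discrete, Abelian) Pontryagin dual group of $G$. For a measurable $f:G\to\mathbb{R}$, $\alpha\in G$ and the given sequence $(n_k)$, the nonconventional ergodic averages are $$M_N^{\alpha}f(x)=\frac{1}{N+1} \sum_{k=0}^N f(x+n_k\alpha),$$ and $$\Gamma_f=\{\alpha \in G: M_N^{\alpha} f(x) \text{ converges as } N\to\infty \text{ for } m\text{-a.e. } x\in G\}.$$ Definition (ergodic sequences). The sequence $(n_k)$ is ergodic mod $q$ if for every $h \in \mathbb{Z}$ $$\lim_{N \to \infty} \frac{1}{N+1}\sum_{k=0}^N \chi_{h,q} (n_k) = \frac{1}{q},$$ where $\chi_{h,q}(x)=1$ if $x \equiv h \pmod q$ and $\chi_{h,q}(x)=0$ otherwise. The sequence $(n_k)$ is ergodic for periodic systems if it is ergodic mod $q$ for every positive integer $q$. Definition (torsion). A group $A$ contains infinitely many multiple torsion if either (i) there is a prime number $p$ such that $A$ contains a subgroup algebraically isomorphic to the direct sum $(\mathbb{Z}/p)\oplus(\mathbb{Z}/p)\oplus\cdots$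 of countably infinitely many copies of $\mathbb{Z}/p$; or (ii) there are infinitely many different prime numbers $p_1,p_2,\dots$ such that for every $j$ the group $A$ contains a subgroup isomorphic to $(\mathbb{Z}/p_j)\times(\mathbb{Z}/p_j)$. *)

theory Defs
  imports
    "HOL-Analysis.Analysis"
    "HOL-Algebra.Elementary_Groups"
    "HOL-Algebra.Product_Groups"
    "HOL-Number_Theory.Cong"
begin

text \<open>
  A compact Abelian group is a type of class \<open>{topological_ab_group_add, t2_space}\<close> together with
  the assumption \<open>compact UNIV\<close>; as usual, the Hausdorff axiom is part of the notion.
\<close>

text \<open>
  The group need not be metrizable, so regularity of a finite Borel measure is not automatic
  and has to be part of the definition.
\<close>

definition haar_prob :: "'a::topological_ab_group_add measure \<Rightarrow> bool" where
  "haar_prob m \<longleftrightarrow>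
     sets m = sets borel \<and>
     emeasure m UNIV = 1 \<and>
     (\<forall>A\<in>sets m. \<forall>a. emeasure m ((\<lambda>x. a + x) ` A) = emeasure m A) \<and>
     (\<forall>A\<in>sets m. emeasure m A = (INF U\<in>{U. open U \<and> A \<subseteq> U}. emeasure m U)) \<and>
     (\<forall>U. open U \<longrightarrow> emeasure m U = (SUP K\<in>{K. compact K \<and> closed K \<and> K \<subseteq> U}. emeasure m K))"

definition zmult :: "int \<Rightarrow> 'a::ab_group_add \<Rightarrow> 'a" where
  "zmult k a = (if k \<ge> 0 then (\<Sum>i<nat k. a) else - (\<Sum>i<nat (- k). a))"

definition nonconv_avg ::
  "(nat \<Rightarrow> int) \<Rightarrow> ('a::ab_group_add \<Rightarrow> real) \<Rightarrow> 'a \<Rightarrow> nat \<Rightarrow> 'a \<Rightarrow> real" where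
  "nonconv_avg n f \<alpha> N x = (\<Sum>k=0..N. f (x + zmult (n k) \<alpha>)) / (real N + 1)"

definition conv_set ::
  "'a::ab_group_add measure \<Rightarrow> (nat \<Rightarrow> int) \<Rightarrow> ('a \<Rightarrow> real) \<Rightarrow> 'a set" where
  "conv_set m n f = {\<alpha>. AE x in m. convergent (\<lambda>N. nonconv_avg n f \<alpha> N x)}"

definition ergodic_mod :: "(nat \<Rightarrow> int) \<Rightarrow> nat \<Rightarrow> bool" where
  "ergodic_mod n q \<longleftrightarrow>
     (\<forall>h::int. (\<lambda>N. (\<Sum>k=0..N. if [n k = h] (mod int q) then 1 else 0) / (real N + 1))
        \<longlonglongrightarrow> 1 / real q)"

definition ergodic_periodic :: "(nat \<Rightarrow> int) \<Rightarrow> bool" where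
  "ergodic_periodic n \<longleftrightarrow> (\<forall>q>0. ergodic_mod n q)"

text \<open>
  The dual group: continuous homomorphisms into the unit circle with pointwise multiplication.
  Only its algebraic structure is recorded, since for a compact group its topology is discrete.
\<close>

definition dual_group :: "('a::topological_ab_group_add \<Rightarrow> complex) monoid" where
  "dual_group =
     \<lparr>carrier = {\<xi>. continuous_on UNIV \<xi> \<and> (\<forall>x. norm (\<xi> x) = 1) \<and> (\<forall>x y. \<xi> (x + y) = \<xi> x * \<xi> y)},
      monoid.mult = (\<lambda>\<xi> \<psi> x. \<xi> x * \<psi> x),
      one = (\<lambda>x. 1)\<rparr>"

lemma comm_group_dual_group: "comm_group (dual_group :: ('a::topological_ab_group_add \<Rightarrow> complex) monoid)"
proof (rule comm_groupI)
  fix \<xi> :: "'a \<Rightarrow> complex"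
  assume \<xi>: "\<xi> \<in> carrier dual_group"
  then have nz: "\<xi> x \<noteq> 0" for x
    by (auto simp: dual_group_def) (metis norm_zero zero_neq_one)
  have "(\<lambda>x. inverse (\<xi> x)) \<in> carrier dual_group"
    using \<xi> nz by (auto simp: dual_group_def norm_inverse intro!: continuous_intros)
  moreover have "(\<lambda>x. inverse (\<xi> x)) \<otimes>\<^bsub>dual_group\<^esub> \<xi> = \<one>\<^bsub>dual_group\<^esub>"
    using nz by (simp add: dual_group_def)
  ultimately show "\<exists>\<psi>\<in>carrier dual_group. \<psi> \<otimes>\<^bsub>dual_group\<^esub> \<xi> = \<one>\<^bsub>dual_group\<^esub>"
    by blast
qed (auto simp: dual_group_def norm_mult mult_ac intro!: continuous_intros)

text \<open>\<open>sum_group\<close> is the direct sum, i.e. the finitely supported elements of the product.\<close>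

definition infinitely_many_multiple_torsion :: "('g, 'b) monoid_scheme \<Rightarrow> bool" where
  "infinitely_many_multiple_torsion A \<longleftrightarrow>
     (\<exists>p::nat. prime p \<and>
        (\<exists>H. subgroup H A \<and>
           (A\<lparr>carrier := H\<rparr>) \<cong> sum_group (UNIV :: nat set) (\<lambda>_. integer_mod_group p))) \<or>
     infinite {p::nat. prime p \<and>
        (\<exists>H. subgroup H A \<and>
           (A\<lparr>carrier := H\<rparr>) \<cong> (integer_mod_group p \<times>\<times> integer_mod_group p))}"

end

theory Submission
  imports Defs "HOL-Probability.Probability_Measure"
begin

text \<open>
  A finite subgroup \<open>F\<close> of the dual has an annihilator \<open>B\<close> of measure \<open>1 / card F\<close>.  If \<open>F\<close> has
  exponent \<open>q\<close>, then \<open>x + k \<alpha> \<in> B\<close> depends only on \<open>k\<close> modulo \<open>q\<close>, so the orbit of \<open>x\<close> under any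
  \<open>\<alpha>\<close> meets \<open>B\<close> with probability at most \<open>q / card F\<close>.  Multiple torsion provides
  subgroups \<open>F\<^sub>j\<close> for which this ratio is at most \<open>(1/2)\<^sup>j\<close>.  Then \<open>f = (\<Sum>j. card F\<^sub>j * indicator B\<^sub>j)\<close> has infinite
  integral, while by Borel--Cantelli almost every orbit meets only finitely many \<open>B\<^sub>j\<close>; along such
  an orbit \<open>f\<close> is a finite sum of functions periodic in \<open>k\<close>, whose averages converge because \<open>(n\<^sub>k)\<close> is
  ergodic for periodic systems.
\<close>

section \<open>Finite subgroups of small exponent\<close>

text \<open>This lets the counting take place inside the concrete torsion models. The inverse
  isomorphism, followed by the inclusion of \<open>H\<close>, is an injective homomorphism from
  \<open>S\<close> to \<open>A\<close>, so the image of \<open>T\<close> keeps both its cardinality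
  and its exponent.\<close>

lemma transport_finite_subgroup:
  assumes A: "group A" and H: "subgroup H A" and S: "group S" and iso: "(A\<lparr>carrier := H\<rparr>) \<cong> S"
    and T: "subgroup T S" "finite T" "\<And>x. x \<in> T \<Longrightarrow> x [^]\<^bsub>S\<^esub> (q::nat) = \<one>\<^bsub>S\<^esub>"
  shows "\<exists>F. subgroup F A \<and> finite F \<and> card F = card T \<and> (\<forall>x\<in>F. x [^]\<^bsub>A\<^esub> q = \<one>\<^bsub>A\<^esub>)"
proof -
  have AH: "group (A\<lparr>carrier := H\<rparr>)"
    using A H by (rule group.subgroup_imp_group)
  obtain h where "h \<in> iso S (A\<lparr>carrier := H\<rparr>)"
    using group.iso_sym[OF AH iso] by (auto simp: is_iso_def)
  then have hom: "h \<in> hom S A" and inj: "inj_on h (carrier S)"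
    using subgroup.subset[OF H] by (auto simp: iso_def hom_def bij_betw_def Pi_iff)
  interpret group_hom S A h
    by (intro group_hom.intro group_hom_axioms.intro S A hom)
  have TS: "T \<subseteq> carrier S"
    using T(1) by (rule subgroup.subset)
  have "(h x) [^]\<^bsub>A\<^esub> q = \<one>\<^bsub>A\<^esub>" if "x \<in> T" for x
    using hom_nat_pow[of x q] that TS T(3)[OF that] by auto
  moreover have "card (h ` T) = card T"
    using card_image inj_on_subset[OF inj TS] by blast
  ultimately show ?thesis
    using subgroup_img_is_subgroup[OF T(1)] T(2) by (intro exI[of _ "h ` T"]) auto
qed

lemma pow_sum_group:
  assumes "\<And>i. i \<in> I \<Longrightarrow> group (G i)" "x \<in> carrier (sum_group I G)"
  shows "x [^]\<^bsub>sum_group I G\<^esub> (k::nat) = (\<lambda>i\<in>I. x i [^]\<^bsub>G i\<^esub> k)"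
proof (induction k)
  case (Suc k)
  then show ?case
    using assms by (auto simp: group.is_monoid intro!: restrict_ext)
qed auto

text \<open>Both kinds of torsion give \<open>q = p\<close>. A group of exponent \<open>p\<close>
  and rank at least two has order exceeding \<open>p\<close> by a factor as large as desired: by
  raising the rank for fixed \<open>p\<close>, or by raising \<open>p\<close> at rank two.\<close>

lemma multiple_torsion_finite_subgroup:
  fixes K :: nat
  assumes A: "group A" and tors: "infinitely_many_multiple_torsion A"
  shows "\<exists>F q. subgroup F A \<and> finite F \<and> 0 < q \<and> K * q \<le> card F \<and> (\<forall>x\<in>F. x [^]\<^bsub>A\<^esub> q = \<one>\<^bsub>A\<^esub>)"
  using tors unfolding infinitely_many_multiple_torsion_def
proof (elim disjE exE conjE)
  fix p H
  assume p: "prime (p::nat)" and H: "subgroup H A"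
    and iso: "A\<lparr>carrier := H\<rparr> \<cong> sum_group (UNIV :: nat set) (\<lambda>_. integer_mod_group p)"
  let ?S = "sum_group (UNIV :: nat set) (\<lambda>_. integer_mod_group p)"
  have p1: "1 < p"
    using p by (rule prime_gt_1_nat)
  \<comment> \<open>The coordinate beyond the first \<open>K\<close> pays for the factor
    \<open>q = p\<close>: the order will be \<open>p * p ^ K\<close>, and
    \<open>K \<le> p ^ K\<close>.\<close>
  define J where "J = Suc K"
  define T where "T = (PiE UNIV (\<lambda>i. if i < J then {0..<int p} else {0}))"
  have S: "group ?S"
    by simp
  have carS: "carrier ?S = {x. (\<forall>i. x i \<in> {0..<int p}) \<and> finite {i. x i \<noteq> 0}}"
    using p1 by (auto simp: carrier_sum_group carrier_integer_mod_group PiE_iff)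
  have T_iff: "x \<in> T \<longleftrightarrow> (\<forall>i. x i \<in> {0..<int p}) \<and> (\<forall>i\<ge>J. x i = 0)" for x
  proof -
    have "x i \<in> (if i < J then {0..<int p} else {0}) \<longleftrightarrow> x i \<in> {0..<int p} \<and> (J \<le> i \<longrightarrow> x i = 0)" for i
      using p1 by auto
    then show ?thesis
      unfolding T_def PiE_UNIV_domain Pi_iff by blast
  qed
  have TS: "T \<subseteq> carrier ?S"
  proof
    fix x assume "x \<in> T"
    then have "{i. x i \<noteq> 0} \<subseteq> {..<J}"
      by (auto simp: T_iff not_less) (meson not_le)
    then show "x \<in> carrier ?S"
      using \<open>x \<in> T\<close> finite_subset by (auto simp: carS T_iff)
  qed
  have sub: "subgroup T ?S"
  proof (rule group.subgroupI[OF S TS])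
    have "(\<lambda>_. 0) \<in> T"
      using p1 by (auto simp: T_iff)
    then show "T \<noteq> {}" by blast
  next
    fix x assume x: "x \<in> T"
    then have "x i \<in> carrier (integer_mod_group p)" for i
      using p1 by (auto simp: T_iff carrier_integer_mod_group)
    then show "inv\<^bsub>?S\<^esub> x \<in> T"
      using x p1 TS by (subst inv_sum_group) (auto simp: T_iff)
  next
    fix x y assume "x \<in> T" "y \<in> T"
    then show "x \<otimes>\<^bsub>?S\<^esub> y \<in> T"
      using p1 by (auto simp: T_iff)
  qed
  let ?r = "\<lambda>x. restrict x {..<J}" and ?z = "\<lambda>y i. if i < J then y i else 0"
  \<comment> \<open>Truncation to the first \<open>J\<close> coordinates is inverted by extension
    with zeros.\<close>
  have bij: "bij_betw ?r T (PiE {..<J} (\<lambda>_. {0..<int p}))"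
  proof (rule bij_betw_byWitness[where f' = ?z])
    show "\<forall>x\<in>T. ?z (?r x) = x"
      unfolding T_iff by (intro ballI ext) (simp add: T_iff)
    show "\<forall>y\<in>PiE {..<J} (\<lambda>_. {0..<int p}). ?r (?z y) = y"
    proof (intro ballI ext)
      fix y i assume "y \<in> PiE {..<J} (\<lambda>_. {0..<int p})"
      then show "?r (?z y) i = y i"
        using PiE_arb[of y "{..<J}" "\<lambda>_. {0..<int p}" i] by (cases "i < J") simp_all
    qed
    show "?r ` T \<subseteq> PiE {..<J} (\<lambda>_. {0..<int p})"
    proof (intro image_subsetI)
      fix x assume "x \<in> T"
      then show "?r x \<in> PiE {..<J} (\<lambda>_. {0..<int p})"
        unfolding T_iff by (intro PiE_I) simp_all
    qed
    show "?z ` PiE {..<J} (\<lambda>_. {0..<int p}) \<subseteq> T"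
    proof (intro image_subsetI)
      fix y assume "y \<in> PiE {..<J} (\<lambda>_. {0..<int p})"
      then have "y i \<in> {0..<int p}" if "i < J" for i
        using that PiE_mem[of y "{..<J}" "\<lambda>_. {0..<int p}" i] by simp
      then show "?z y \<in> T"
        using p1 by (simp add: T_iff)
    qed
  qed
  have card: "card T = p ^ J"
    using bij_betw_same_card[OF bij] by (simp add: card_PiE)
  \<comment> \<open>An infinite set would have \<open>card\<close> equal to 0, but
    \<open>p ^ J\<close> is nonzero.\<close>
  then have fin: "finite T"
    using p1 by (metis card.infinite not_one_less_zero power_eq_0_iff)
  have exp: "x [^]\<^bsub>?S\<^esub> p = \<one>\<^bsub>?S\<^esub>" if "x \<in> T" for x
    using that TS by (subst pow_sum_group) auto
  have "K \<le> p ^ K"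
    using power_gt_expt[of p K] p1 by simp
  then have "K * p \<le> card T"
    unfolding card J_def by simp
  then show ?thesis
    using transport_finite_subgroup[OF A H S iso sub fin exp] p1 by (metis gr_zeroI not_less_zero)
next
  assume inf: "infinite {p. prime (p::nat) \<and>
    (\<exists>H. subgroup H A \<and> A\<lparr>carrier := H\<rparr> \<cong> integer_mod_group p \<times>\<times> integer_mod_group p)}"
  \<comment> \<open>An infinite set of primes is unbounded, so it has a member \<open>p\<close> with
    \<open>K \<le> p\<close>; the whole group of order \<open>p * p\<close> then serves as
    \<open>T\<close>.\<close>
  then obtain p H where p: "prime p" "K \<le> p" and H: "subgroup H A"
    and iso: "A\<lparr>carrier := H\<rparr> \<cong> integer_mod_group p \<times>\<times> integer_mod_group p"
    unfolding infinite_nat_iff_unbounded_le by blast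
  let ?S = "integer_mod_group p \<times>\<times> integer_mod_group p"
  have p1: "1 < p"
    using p(1) by (rule prime_gt_1_nat)
  have S: "group ?S"
    by (simp add: DirProd_group)
  have fin: "finite (carrier ?S)" and card: "card (carrier ?S) = p * p"
    using p1 by (auto simp: carrier_integer_mod_group card_cartesian_product)
  have pow: "(a, b) [^]\<^bsub>?S\<^esub> (k::nat) = (a [^]\<^bsub>integer_mod_group p\<^esub> k, b [^]\<^bsub>integer_mod_group p\<^esub> k)" for a b k
    by (induction k) (auto simp: nat_pow_def add.commute mod_add_right_eq distrib_left mult.commute simp del: pow_integer_mod_group)
  then have exp: "x [^]\<^bsub>?S\<^esub> p = \<one>\<^bsub>?S\<^esub>" for x
    by (cases x) simp
  have "K * p \<le> card (carrier ?S)"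
    unfolding card using p(2) by simp
  then show ?thesis
    using transport_finite_subgroup[OF A H S iso group.subgroup_self[OF S] fin exp] p1
    by (metis gr_zeroI not_less_zero)
qed

section \<open>Annihilators of finite groups of characters\<close>

lemma dual_groupD:
  assumes "\<xi> \<in> carrier dual_group"
  shows "continuous_on UNIV \<xi>" "norm (\<xi> x) = 1" "\<xi> (x + y) = \<xi> x * \<xi> y" "\<xi> x \<noteq> 0"
proof -
  show 1: "continuous_on UNIV \<xi>" "norm (\<xi> x) = 1" "\<xi> (x + y) = \<xi> x * \<xi> y"
    using assms by (auto simp: dual_group_def)
  then show "\<xi> x \<noteq> 0"
    by auto
qed

lemma character_zmult:
  assumes \<xi>: "\<xi> \<in> carrier dual_group"
  shows "\<xi> (zmult k a) = \<xi> a powi k"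
proof -
  note mult = dual_groupD(3)[OF \<xi>] and nz = dual_groupD(4)[OF \<xi>]
  have zero: "\<xi> 0 = 1"
    using mult[of 0 0] nz[of 0] by simp
  have pow: "\<xi> (\<Sum>i<j. a) = \<xi> a ^ j" for j :: nat
    by (induction j) (auto simp: zero mult)
  have minus: "\<xi> (- y) = inverse (\<xi> y)" for y
    using mult[of y "- y"] zero nz[of y] by (simp add: field_simps)
  show ?thesis
    by (simp only: zmult_def minus pow power_int_def power_inverse split: if_split) auto
qed

lemma pow_dual_group: "\<xi> [^]\<^bsub>dual_group\<^esub> (k::nat) = (\<lambda>x. \<xi> x ^ k)"
  by (induction k) (auto simp: dual_group_def nat_pow_def mult.commute)

lemma powi_cong:
  fixes z :: complex
  assumes "z ^ q = 1" "z \<noteq> 0" "[k = l] (mod int q)"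
  shows "z powi k = z powi l"
proof -
  obtain d where "k = l + int q * d"
    using assms(3) by (metis cong_iff_lin cong_sym)
  then show ?thesis
    using assms(1,2) by (simp add: power_int_add power_int_mult)
qed

definition annihilator :: "('a \<Rightarrow> complex) set \<Rightarrow> 'a set" where
  "annihilator F = {x. \<forall>\<xi>\<in>F. \<xi> x = 1}"

lemma closed_annihilator:
  assumes "F \<subseteq> carrier dual_group"
  shows "closed (annihilator F)"
proof -
  have "annihilator F = (\<Inter>\<xi>\<in>F. {x. \<xi> x = 1})"
    by (auto simp: annihilator_def)
  moreover have "closed {x. \<xi> x = 1}" if "\<xi> \<in> F" for \<xi>
    using assms that by (intro closed_Collect_eq continuous_on_const dual_groupD(1)) auto
  ultimately show ?thesis
    by (simp add: closed_INT)
qed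

text \<open>A character in \<open>F\<close> takes the value \<open>\<xi> x * \<xi> a powi k\<close>
  at \<open>x + zmult k a\<close>, and \<open>\<xi> a\<close> is a \<open>q\<close>-th root of
  unity. The period \<open>q\<close> thus serves all \<open>x\<close> and \<open>a\<close> at
  once.\<close>

lemma annihilator_periodic:
  assumes "F \<subseteq> carrier dual_group" "\<And>\<xi>. \<xi> \<in> F \<Longrightarrow> \<xi> [^]\<^bsub>dual_group\<^esub> q = \<one>\<^bsub>dual_group\<^esub>"
    and kl: "[k = l] (mod int q)"
  shows "x + zmult k a \<in> annihilator F \<longleftrightarrow> x + zmult l a \<in> annihilator F"
proof -
  have "\<xi> (x + zmult k a) = \<xi> (x + zmult l a)" if "\<xi> \<in> F" for \<xi>
  proof -
    have \<xi>: "\<xi> \<in> carrier dual_group"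
      using assms(1) that by blast
    have "\<xi> a ^ q = 1"
      using assms(2)[OF that] unfolding pow_dual_group by (auto simp: dual_group_def fun_eq_iff)
    then show ?thesis
      using powi_cong[OF _ dual_groupD(4)[OF \<xi>] kl]
      by (simp add: dual_groupD(3)[OF \<xi>] character_zmult[OF \<xi>])
  qed
  then show ?thesis
    unfolding annihilator_def mem_Collect_eq by metis
qed

section \<open>Haar measure and orthogonality of characters\<close>

lemma haar_prob_space:
  assumes "haar_prob m"
  shows "space m = UNIV" "sets m = sets borel" "prob_space m"
proof -
  show s: "sets m = sets borel"
    using assms by (simp add: haar_prob_def)
  then show sp: "space m = UNIV"
    using sets_eq_imp_space_eq[OF s] by simp
  show "prob_space m"
    using assms sp by (intro prob_spaceI) (simp add: haar_prob_def)
qed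

lemma borel_measurable_haar:
  assumes "haar_prob m" "continuous_on UNIV f"
  shows "f \<in> borel_measurable m"
  using borel_measurable_continuous_onI[OF assms(2)] measurable_cong_sets[OF haar_prob_space(2)[OF assms(1)] refl]
  by blast

lemma haar_distr_translation:
  fixes m :: "'a::topological_ab_group_add measure"
  assumes m: "haar_prob m"
  shows "(\<lambda>x. x + a) \<in> measurable m m" "distr m m (\<lambda>x. x + a) = m"
proof -
  note [simp] = haar_prob_space(1,2)[OF m]
  have inv: "\<forall>A\<in>sets m. \<forall>b. emeasure m ((\<lambda>x. b + x) ` A) = emeasure m A"
    using m unfolding haar_prob_def by (elim conjE) assumption
  have "(\<lambda>x. x + a) \<in> borel_measurable m"
    by (intro borel_measurable_haar[OF m] continuous_intros)
  then show meas: "(\<lambda>x. x + a) \<in> measurable m m"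
    using measurable_cong_sets[OF refl haar_prob_space(2)[OF m], of m] by blast
  show "distr m m (\<lambda>x. x + a) = m"
  proof (rule measure_eqI)
    fix A assume "A \<in> sets (distr m m (\<lambda>x. x + a))"
    then have A: "A \<in> sets m" by simp
    \<comment> \<open>\<open>haar_prob\<close> states invariance for images, so the preimage under
      translation by \<open>a\<close> is rewritten as the image under translation by
      \<open>- a\<close>.\<close>
    have "x \<in> (\<lambda>x. - a + x) ` A" if "x + a \<in> A" for x
      using that by (intro image_eqI[of _ _ "x + a"]) (simp_all add: algebra_simps)
    moreover have "(- a + y) + a = y" for y
      by simp
    ultimately have "(\<lambda>x. x + a) -` A = (\<lambda>x. - a + x) ` A"
      by (intro equalityI subsetI) (simp, metis imageE vimageI2)
    moreover have "emeasure m ((\<lambda>x. - a + x) ` A) = emeasure m A"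
      by (rule inv[rule_format, OF A])
    ultimately show "emeasure (distr m m (\<lambda>x. x + a)) A = emeasure m A"
      using A meas by (simp add: emeasure_distr)
  qed simp
qed

text \<open>Translating by \<open>a\<close> leaves the integral unchanged but also multiplies it by
  \<open>\<xi> a\<close>, which differs from 1.\<close>

lemma integral_nontrivial_character:
  assumes m: "haar_prob m" and \<xi>: "\<xi> \<in> carrier dual_group" and nt: "\<xi> a \<noteq> 1"
  shows "(\<integral>x. \<xi> x \<partial>m) = 0"
proof -
  have "(\<integral>x. \<xi> x \<partial>m) = (\<integral>x. \<xi> x \<partial>distr m m (\<lambda>x. x + a))"
    by (simp add: haar_distr_translation[OF m])
  also have "\<dots> = (\<integral>x. \<xi> (x + a) \<partial>m)"
    by (intro integral_distr haar_distr_translation[OF m] borel_measurable_haar[OF m] dual_groupD(1)[OF \<xi>])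
  also have "\<dots> = (\<integral>x. \<xi> x \<partial>m) * \<xi> a"
    by (simp add: dual_groupD(3)[OF \<xi>])
  finally have "(\<integral>x. \<xi> x \<partial>m) * (\<xi> a - 1) = 0"
    by (simp add: algebra_simps)
  then show ?thesis
    using nt by simp
qed

text \<open>Off the annihilator some \<open>\<psi>\<close> in \<open>F\<close> has
  \<open>\<psi> x\<close> different from 1; multiplication by \<open>\<psi>\<close> permutes
  \<open>F\<close>, so the sum equals \<open>\<psi> x\<close> times itself and vanishes. For
  infinite \<open>F\<close> both sides are 0 by the conventions for \<open>sum\<close> and
  \<open>card\<close>.\<close>

lemma sum_characters:
  fixes F :: "('a::topological_ab_group_add \<Rightarrow> complex) set"
  assumes F: "subgroup F dual_group"
  shows "(\<Sum>\<xi>\<in>F. \<xi> x) = of_nat (card F) * indicator (annihilator F) x"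
proof (cases "x \<in> annihilator F")
  case False
  then obtain \<psi> where \<psi>: "\<psi> \<in> F" "\<psi> x \<noteq> 1"
    by (auto simp: annihilator_def)
  interpret D: comm_group "dual_group :: ('a \<Rightarrow> complex) monoid"
    by (rule comm_group_dual_group)
  have sub: "F \<subseteq> carrier dual_group"
    using F by (rule subgroup.subset)
  have bij: "bij_betw (\<lambda>\<xi>. \<psi> \<otimes>\<^bsub>dual_group\<^esub> \<xi>) F F"
  proof (rule bij_betw_byWitness[where f' = "\<lambda>\<xi>. inv\<^bsub>dual_group\<^esub> \<psi> \<otimes>\<^bsub>dual_group\<^esub> \<xi>"])
    show "\<forall>\<xi>\<in>F. inv\<^bsub>dual_group\<^esub> \<psi> \<otimes>\<^bsub>dual_group\<^esub> (\<psi> \<otimes>\<^bsub>dual_group\<^esub> \<xi>) = \<xi>"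
      using \<psi>(1) sub by (auto simp: D.m_assoc[symmetric] subset_iff)
    show "\<forall>\<xi>\<in>F. \<psi> \<otimes>\<^bsub>dual_group\<^esub> (inv\<^bsub>dual_group\<^esub> \<psi> \<otimes>\<^bsub>dual_group\<^esub> \<xi>) = \<xi>"
      using \<psi>(1) sub by (auto simp: D.m_assoc[symmetric] subset_iff)
  qed (use F \<psi>(1) in \<open>auto intro: subgroup.m_closed subgroup.m_inv_closed\<close>)
  have "(\<Sum>\<xi>\<in>F. \<xi> x) = (\<Sum>\<xi>\<in>F. (\<psi> \<otimes>\<^bsub>dual_group\<^esub> \<xi>) x)"
    using sum.reindex_bij_betw[OF bij, of "\<lambda>\<xi>. \<xi> x"] by simp
  also have "\<dots> = \<psi> x * (\<Sum>\<xi>\<in>F. \<xi> x)"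
    by (simp add: dual_group_def sum_distrib_left)
  finally have "(\<psi> x - 1) * (\<Sum>\<xi>\<in>F. \<xi> x) = 0"
    by (simp add: algebra_simps)
  then show ?thesis
    using \<psi>(2) False by simp
next
  case True
  then have "(\<Sum>\<xi>\<in>F. \<xi> x) = (\<Sum>\<xi>\<in>F. 1)"
    by (intro sum.cong) (auto simp: annihilator_def)
  then show ?thesis
    using True by simp
qed

text \<open>Integrate the character sum: only the trivial character contributes, and its integral is
  1.\<close>

lemma measure_annihilator:
  assumes m: "haar_prob m" and F: "subgroup F dual_group" "finite F"
  shows "real (card F) * measure m (annihilator F) = 1"
proof -
  interpret prob_space m
    using m by (rule haar_prob_space)
  have sub: "F \<subseteq> carrier dual_group" and one: "(\<lambda>_. 1) \<in> F"
    using subgroup.subset[OF F(1)] subgroup.one_closed[OF F(1)] by (auto simp: dual_group_def)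
  have B: "annihilator F \<in> sets m"
    using closed_annihilator[OF sub] haar_prob_space(2)[OF m] by simp
  have int: "integrable m \<xi>" if "\<xi> \<in> F" for \<xi>
    using that sub dual_groupD(1,2)[of \<xi>]
    by (intro integrable_const_bound[of _ 1] borel_measurable_haar[OF m]) auto
  have "complex_of_real (real (card F) * measure m (annihilator F)) =
      (\<integral>x. of_nat (card F) * indicator (annihilator F) x \<partial>m)"
  proof -
    have "(indicator (annihilator F) x :: complex) = of_real (indicator (annihilator F) x)" for x
      by (simp add: indicator_def)
    then show ?thesis
      using B by (simp add: haar_prob_space(1)[OF m])
  qed
  also have "\<dots> = (\<integral>x. (\<Sum>\<xi>\<in>F. \<xi> x) \<partial>m)"
    by (simp add: sum_characters[OF F(1)])
  also have "\<dots> = (\<Sum>\<xi>\<in>F. \<integral>x. \<xi> x \<partial>m)"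
    using int by (rule Bochner_Integration.integral_sum)
  also have "\<dots> = (\<Sum>\<xi>\<in>F. if \<xi> = (\<lambda>_. 1) then 1 else 0)"
  proof (rule sum.cong[OF refl])
    fix \<xi> assume "\<xi> \<in> F"
    then show "(\<integral>x. \<xi> x \<partial>m) = (if \<xi> = (\<lambda>_. 1) then 1 else 0)"
      using integral_nontrivial_character[OF m, of \<xi>] sub prob_space by (auto simp: fun_eq_iff)
  qed
  also have "\<dots> = 1"
    using F(2) one by simp
  finally show ?thesis
    by (metis of_real_eq_1_iff)
qed

section \<open>Averages of sums of periodic sets\<close>

text \<open>A \<open>q\<close>-periodic function is a linear combination of indicators of residue
  classes mod \<open>q\<close>. By ergodicity each indicator averages to \<open>1 / q\<close>, so
  the limit is the mean of \<open>g\<close> over one period.\<close>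

lemma average_periodic_convergent:
  fixes g :: "int \<Rightarrow> real"
  assumes n: "ergodic_periodic n" and q: "0 < q"
    and per: "\<And>k l. [k = l] (mod int q) \<Longrightarrow> g k = g l"
  shows "convergent (\<lambda>N. (\<Sum>k=0..N. g (n k)) / (real N + 1))"
proof -
  have decomp: "g i = (\<Sum>h\<in>{0..<int q}. g h * (if [i = h] (mod int q) then 1 else 0))" for i
  proof -
    have "(\<Sum>h\<in>{0..<int q}. g h * (if [i = h] (mod int q) then 1 else 0)) =
        (\<Sum>h\<in>{0..<int q}. if i mod int q = h then g h else 0)"
      by (intro sum.cong refl) (auto simp: cong_def)
    also have "\<dots> = g (i mod int q)"
      using q by simp
    also have "\<dots> = g i"
      by (intro per) (simp add: cong_def)
    finally show ?thesis ..
  qed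
  have "(\<lambda>N. \<Sum>h\<in>{0..<int q}. g h * ((\<Sum>k=0..N. if [n k = h] (mod int q) then 1 else 0) / (real N + 1)))
      \<longlonglongrightarrow> (\<Sum>h\<in>{0..<int q}. g h * (1 / real q))"
    using n q by (intro tendsto_sum tendsto_mult_left) (auto simp: ergodic_periodic_def ergodic_mod_def)
  moreover have "(\<Sum>h\<in>{0..<int q}. g h * ((\<Sum>k=0..N. if [n k = h] (mod int q) then 1 else 0) / (real N + 1)))
      = (\<Sum>k=0..N. g (n k)) / (real N + 1)" for N
  proof -
    have "(\<Sum>k=0..N. g (n k)) =
        (\<Sum>k=0..N. \<Sum>h\<in>{0..<int q}. g h * (if [n k = h] (mod int q) then 1 else 0))"
      by (intro sum.cong refl decomp)
    also have "\<dots> = (\<Sum>h\<in>{0..<int q}. g h * (\<Sum>k=0..N. if [n k = h] (mod int q) then 1 else 0))"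
      unfolding sum_distrib_left by (rule sum.swap)
    finally show ?thesis
      by (simp only: sum_divide_distrib[where A = "{0..<int q}"] times_divide_eq_right)
  qed
  ultimately show ?thesis
    by (simp add: convergent_def) blast
qed

text \<open>By periodicity the points whose orbit ever meets \<open>B j\<close> are covered by only
  \<open>q j\<close> translates of \<open>B j\<close>, of total measure at most
  \<open>(1/2) ^ j\<close>. This is summable, so Borel-Cantelli applies. The exceptional null set
  may depend on \<open>a\<close>, as \<open>conv_set\<close> permits.\<close>

lemma AE_orbit_avoids:
  fixes m :: "'a::topological_ab_group_add measure" and B :: "nat \<Rightarrow> 'a set"
  assumes m: "haar_prob m" and B: "\<And>j. B j \<in> sets m" and q: "\<And>j. 0 < q j"
    and per: "\<And>j k l x a. [k = l] (mod int (q j)) \<Longrightarrow> x + zmult k a \<in> B j \<longleftrightarrow> x + zmult l a \<in> B j"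
    and small: "\<And>j. real (q j) * measure m (B j) \<le> (1/2) ^ j"
  shows "AE x in m. \<forall>\<^sub>F j in sequentially. \<forall>k. x + zmult k a \<notin> B j"
proof -
  interpret prob_space m
    using m by (rule haar_prob_space)
  define T where "T k j = {x. x + zmult k a \<in> B j}" for k j
  define E where "E j = (\<Union>k\<in>{0..<int (q j)}. T k j)" for j
  have T: "T k j \<in> sets m" "measure m (T k j) = measure m (B j)" for k j
  proof -
    note tr = haar_distr_translation[OF m, of "zmult k a"]
    have eq: "T k j = (\<lambda>x. x + zmult k a) -` B j \<inter> space m"
      by (auto simp: T_def haar_prob_space(1)[OF m])
    show "T k j \<in> sets m"
      unfolding eq using tr(1) B by (rule measurable_sets)
    show "measure m (T k j) = measure m (B j)"
      unfolding eq using measure_distr[OF tr(1) B] tr(2) by simp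
  qed
  have E: "E j \<in> sets m" for j
    unfolding E_def using T(1) by (intro sets.finite_UN) auto
  have "measure m (E j) \<le> (1/2) ^ j" for j
  proof -
    have "measure m (E j) \<le> (\<Sum>k\<in>{0..<int (q j)}. measure m (T k j))"
      unfolding E_def using T(1) by (intro finite_measure_subadditive_finite) auto
    then show ?thesis
      using small[of j] by (simp add: T(2))
  qed
  then have "summable (\<lambda>j. measure m (E j))"
    by (intro summable_comparison_test'[OF summable_geometric[of "1/2::real"], of 0]) auto
  then have "AE x in m. \<forall>\<^sub>F j in sequentially. x \<in> space m - E j"
    by (intro borel_cantelli_AE1 E) (simp_all add: emeasure_eq_measure)
  then show ?thesis
  proof (rule eventually_mono)
    fix x assume "\<forall>\<^sub>F j in sequentially. x \<in> space m - E j"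
    then show "\<forall>\<^sub>F j in sequentially. \<forall>k. x + zmult k a \<notin> B j"
    proof (rule eventually_mono, intro allI)
      \<comment> \<open>\<open>E j\<close> only involves times in one period; an arbitrary
        \<open>k\<close> is reduced to its residue.\<close>
      fix j k assume "x \<in> space m - E j"
      moreover have "k mod int (q j) \<in> {0..<int (q j)}"
        using q[of j] by simp
      ultimately have "x + zmult (k mod int (q j)) a \<notin> B j"
        by (auto simp: E_def T_def)
      then show "x + zmult k a \<notin> B j"
        using per[of "k mod int (q j)" k j x a] by (simp add: cong_def)
    qed
  qed
qed

lemma nonintegrable_function_of_periodic_sets:
  fixes m :: "'a::topological_ab_group_add measure" and B :: "nat \<Rightarrow> 'a set"
  assumes m: "haar_prob m" and n: "ergodic_periodic n"
    and B: "\<And>j. B j \<in> sets m" and pos: "\<And>j. 0 < measure m (B j)" and q: "\<And>j. 0 < q j"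
    and per: "\<And>j k l x a. [k = l] (mod int (q j)) \<Longrightarrow> x + zmult k a \<in> B j \<longleftrightarrow> x + zmult l a \<in> B j"
    and small: "\<And>j. real (q j) * measure m (B j) \<le> (1/2) ^ j"
  shows "\<exists>f :: 'a \<Rightarrow> real. f \<in> borel_measurable m \<and> \<not> integrable m f \<and> conv_set m n f = UNIV"
proof -
  interpret prob_space m
    using m by (rule haar_prob_space)
  \<comment> \<open>Each bump is normalized to integral 1. For an annihilator the factor is the
    order of the character group.\<close>
  define u where "u j x = indicator (B j) x / measure m (B j)" for j x
  \<comment> \<open>Where the series diverges \<open>suminf\<close> is an unspecified real; this
    concerns only points lying in infinitely many \<open>B j\<close>, a null set.\<close>
  define f where "f x = (\<Sum>j. u j x)" for x
  note avoids = AE_orbit_avoids[OF m B q per small]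
  have meas: "f \<in> borel_measurable m"
    unfolding f_def[abs_def] u_def using B by measurable
  have "conv_set m n f = UNIV"
  proof -
    have "AE x in m. convergent (\<lambda>N. nonconv_avg n f a N x)" for a
      using avoids[of a]
    proof (rule eventually_mono)
      fix x assume "\<forall>\<^sub>F j in sequentially. \<forall>k. x + zmult k a \<notin> B j"
      then obtain J where J: "x + zmult k a \<notin> B j" if "J \<le> j" for j k
        by (auto simp: eventually_sequentially)
      \<comment> \<open>The cutoff \<open>J\<close> is the same for all \<open>k\<close>, so along
        the whole orbit \<open>f\<close> is one fixed finite sum of functions periodic in
        \<open>k\<close>.\<close>
      have "f (x + zmult k a) = (\<Sum>j<J. u j (x + zmult k a))" for k
        unfolding f_def using J by (intro suminf_finite) (auto simp: u_def not_less)
      then have "nonconv_avg n f a N x =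
          (\<Sum>j<J. (\<Sum>k=0..N. u j (x + zmult (n k) a)) / (real N + 1))" for N
        by (simp only: nonconv_avg_def sum_divide_distrib) (rule sum.swap)
      moreover have "convergent (\<lambda>N. (\<Sum>k=0..N. u j (x + zmult (n k) a)) / (real N + 1))" for j
        using per[of _ _ j x a]
        by (intro average_periodic_convergent[OF n q[of j], where g = "\<lambda>k. u j (x + zmult k a)"])
           (simp add: u_def indicator_def)
      ultimately show "convergent (\<lambda>N. nonconv_avg n f a N x)"
        by (simp add: convergent_sum)
    qed
    then show ?thesis
      by (auto simp: conv_set_def)
  qed
  moreover have "\<not> integrable m f"
  proof
    assume int: "integrable m f"
    have int_u: "integrable m (u j)" "(\<integral>x. u j x \<partial>m) = 1" for j
      using B[of j] pos[of j] by (auto simp: u_def[abs_def] emeasure_eq_measure haar_prob_space(1)[OF m])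
    \<comment> \<open>The first \<open>J\<close> bumps have total integral \<open>J\<close> and lie
      below \<open>f\<close> almost everywhere, so an integrable \<open>f\<close> would have an
      integral above every natural number.\<close>
    have "real J \<le> (\<integral>x. f x \<partial>m)" for J
    proof -
      have "(\<integral>x. (\<Sum>j<J. u j x) \<partial>m) \<le> (\<integral>x. f x \<partial>m)"
      proof (intro integral_mono_AE int Bochner_Integration.integrable_sum int_u)
        show "AE x in m. (\<Sum>j<J. u j x) \<le> f x"
          \<comment> \<open>The orbit under 0 is the point itself: almost every \<open>x\<close>
            lies in finitely many \<open>B j\<close>, which makes the series summable there.\<close>
          using avoids[of 0]
        proof (rule eventually_mono)
          fix x assume "\<forall>\<^sub>F j in sequentially. \<forall>k. x + zmult k 0 \<notin> B j"
          then obtain J' where "x + zmult 0 0 \<notin> B j" if "J' \<le> j" for j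
            unfolding eventually_sequentially by blast
          then have "x \<notin> B j" if "J' \<le> j" for j
            using that by (simp add: zmult_def)
          then have "summable (\<lambda>j. u j x)"
            by (intro summable_finite[of "{..<J'}"]) (auto simp: u_def not_less)
          then show "(\<Sum>j<J. u j x) \<le> f x"
            unfolding f_def by (intro sum_le_suminf) (auto simp: u_def)
        qed
      qed
      then show ?thesis
        by (simp add: int_u)
    qed
    then show False
      using reals_Archimedean2 not_le by blast
  qed
  ultimately show ?thesis
    using meas by blast
qed

theorem theorem6:
  fixes n :: "nat \<Rightarrow> int"
    and m :: "'a::{topological_ab_group_add, t2_space} measure"
  assumes "strict_mono n"
    and "ergodic_periodic n"
    and "compact (UNIV :: 'a set)"
    and "haar_prob m"
    and "infinitely_many_multiple_torsion (dual_group :: ('a \<Rightarrow> complex) monoid)"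
  shows "\<exists>f :: 'a \<Rightarrow> real. f \<in> borel_measurable m \<and> \<not> integrable m f \<and>
           conv_set m n f = UNIV \<and> emeasure m (conv_set m n f) = 1"
proof -
  let ?D = "dual_group :: ('a \<Rightarrow> complex) monoid"
  note m = \<open>haar_prob m\<close>
  \<comment> \<open>Choosing \<open>K = 2 ^ j\<close> makes the ratio of \<open>q j\<close> to the
    order of \<open>F j\<close> at most \<open>(1/2) ^ j\<close>.\<close>
  have "\<forall>j. \<exists>F q. subgroup F ?D \<and> finite F \<and> 0 < q \<and> 2 ^ j * q \<le> card F \<and>
      (\<forall>\<xi>\<in>F. \<xi> [^]\<^bsub>?D\<^esub> q = \<one>\<^bsub>?D\<^esub>)"
    using multiple_torsion_finite_subgroup[OF comm_group.axioms(2)[OF comm_group_dual_group] assms(5)]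
    by blast
  then obtain F q where F: "subgroup (F j) ?D" "finite (F j)" and q: "0 < q j"
    and card: "2 ^ j * q j \<le> card (F j)"
    and exp: "\<And>\<xi>. \<xi> \<in> F j \<Longrightarrow> \<xi> [^]\<^bsub>?D\<^esub> q j = \<one>\<^bsub>?D\<^esub>" for j :: nat
    by metis
  define B where "B j = annihilator (F j)" for j
  have sub: "F j \<subseteq> carrier ?D" for j
    using F(1) by (rule subgroup.subset)
  have mB: "real (card (F j)) * measure m (B j) = 1" for j
    unfolding B_def using m F by (rule measure_annihilator)
  have "\<exists>f :: 'a \<Rightarrow> real. f \<in> borel_measurable m \<and> \<not> integrable m f \<and> conv_set m n f = UNIV"
  proof (rule nonintegrable_function_of_periodic_sets[OF m \<open>ergodic_periodic n\<close>, of B q])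
    show "B j \<in> sets m" for j
      using closed_annihilator[OF sub] haar_prob_space(2)[OF m] by (simp add: B_def)
    show "0 < measure m (B j)" for j
      \<comment> \<open>A zero measure would contradict that its product with the order of
        \<open>F j\<close> is 1.\<close>
      using mB[of j] by (metis less_eq_real_def measure_nonneg mult_zero_right zero_neq_one)
    show "x + zmult k a \<in> B j \<longleftrightarrow> x + zmult l a \<in> B j" if "[k = l] (mod int (q j))" for j k l x a
      unfolding B_def using sub exp that by (rule annihilator_periodic)
    show "real (q j) * measure m (B j) \<le> (1/2) ^ j" for j
    proof -
      have "2 ^ j * real (q j) \<le> real (card (F j))"
        using card[of j] by (metis of_nat_le_iff of_nat_mult of_nat_numeral of_nat_power)
      then have "2 ^ j * real (q j) * measure m (B j) \<le> 1"
        using mult_right_mono[OF _ measure_nonneg] mB[of j] by metis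
      then show ?thesis
        by (simp add: field_simps)
    qed
  qed (rule q)
  moreover have "emeasure m UNIV = 1"
    using m by (simp add: haar_prob_def)
  ultimately show ?thesis
    by metis
qed

end
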